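(* Let $R$ be an integral domain, let $n\ge1$ and let $g_{(1)}(X),\dots,g_{(n)}(X)\in R[X]$ be monic polynomials of degree $\ge1$. Then $$\mathrm{Res}(g_{(1)},\dots,g_{(n)})=\prod_{1\le k<\ell\le n}\mathrm{Res}(g_{(k)},g_{(\ell)}).$$
   Context: Notation: $[a,b]=\{z\in\mathbb{Z}: a\le z\le b\}$. Generalised Sylvester matrix and resultant: let $n\ge 1$ and let $g_{(1)},\dots,g_{(n)}\in R[X]$ be monic of degrees $m_{(k)}:=\deg g_{(k)}\ge1$. Put $M:=\sum_{j\in[1,n]}m_{(j)}$, $M_{(k)}:=M-m_{(k)}$ and write $\prod_{j\in[1,n]\setminus\{k\}}g_{(j)}(X)=\sum_{i\in[0,M_{(k)}]}a_{(k)i}X^i$. Then $\mathrm{Sylv}(g_{(1)},\dots,g_{(n)})\in R^{M\times M}$ is the matrix consisting of $n$ consecutive blocks of rows, the $k$-th block having $m_{(k)}$ rows; for $p\in[1,m_{(k)}]$, the $p$-th row of the $k$-th block has entry $a_{(k)\,q-p}$ in column $q$ if $p\le q\le p+M_{(k)}$ and entry $0$ in all other columns $q\in[1,M]$. The resultant is $\mathrm{Res}(g_{(1)},\dots,g_{(n)}):=\det\mathrm{Sylv}(g_{(1)},\dots,g_{(n)})\in R$. The factors $\mathrm{Res}(g_{(k)},g_{(\ell)})$ are given by the same definition with two polynomials (which agrees with the classical resultant). *)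

theory Defs
  imports "Jordan_Normal_Form.Determinant"
begin

definition total_degree :: "'a::comm_ring_1 poly list \<Rightarrow> nat" where
  "total_degree gs = (\<Sum>j<length gs. degree (gs ! j))"

definition cofactor_poly :: "'a::comm_ring_1 poly list \<Rightarrow> nat \<Rightarrow> 'a poly" where
  "cofactor_poly gs k = (\<Prod>j\<in>{..<length gs} - {k}. gs ! j)"

text \<open>
  All indices (polynomials, rows within a block, columns) start at 0. Shifting rows and columns
  from 1-based to 0-based leaves \<open>q - p\<close> unchanged. For monic polynomials,
  \<open>total_degree gs - degree (gs ! k)\<close> is the degree of \<open>cofactor_poly gs k\<close>.
\<close>

definition sylv_row :: "'a::comm_ring_1 poly list \<Rightarrow> nat \<Rightarrow> nat \<Rightarrow> 'a vec" where
  "sylv_row gs k p =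
     vec (total_degree gs)
       (\<lambda>q. if p \<le> q \<and> q \<le> p + (total_degree gs - degree (gs ! k))
            then coeff (cofactor_poly gs k) (q - p) else 0)"

definition Sylv :: "'a::comm_ring_1 poly list \<Rightarrow> 'a mat" where
  "Sylv gs =
     mat_of_rows (total_degree gs)
       (concat (map (\<lambda>k. map (sylv_row gs k) [0..<degree (gs ! k)]) [0..<length gs]))"

definition Res :: "'a::comm_ring_1 poly list \<Rightarrow> 'a" where
  "Res gs = det (Sylv gs)"

text \<open>
  The determinant of a non-square matrix is 0 by convention, so the row count matters.
\<close>

lemma Sylv_carrier: "Sylv gs \<in> carrier_mat (total_degree gs) (total_degree gs)"
proof -
  have "length (concat (map (\<lambda>k. map (sylv_row gs k) [0..<degree (gs ! k)]) [0..<length gs]))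
        = (\<Sum>k\<leftarrow>[0..<length gs]. degree (gs ! k))"
    by (simp add: length_concat o_def)
  also have "\<dots> = total_degree gs"
    unfolding total_degree_def sum_list_distinct_conv_sum_set[OF distinct_upt]
    by (simp add: atLeast0LessThan)
  finally show ?thesis
    unfolding Sylv_def by (intro carrier_matI) simp_all
qed

end

theory Submission
  imports Defs "Jordan_Normal_Form.Char_Poly"
begin

text \<open>
  The rows of the Sylvester matrix are the coefficient vectors of the polynomials \<open>X\<^sup>p G\<^sub>k\<close>, where
  \<open>G\<^sub>k\<close> is the product of the \<open>g\<^sub>j\<close> with \<open>j \<noteq> k\<close>. Writing one list of polynomials as linear
  combinations of another factors the determinant. If \<open>f\<close> is put in front of a list \<open>hs\<close>
  with product \<open>H\<close>, every row polynomial outside the first block is \<open>f\<close> times a row polynomial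
  of \<open>hs\<close>, hence a combination of the polynomials \<open>X\<^sup>p f\<close>; this gives \<open>Res (f, hs) = Res hs * Res (f, H)\<close>.
  Reducing the first block modulo \<open>f\<close> shows that \<open>Res (f, g)\<close> is the determinant of
  multiplication by \<open>g\<close> on the free module \<open>R[X]/(f)\<close>, so it is multiplicative in \<open>g\<close>. Induction on
  the list then yields the product formula, with no need for roots in a splitting field.
\<close>

section \<open>Determinants of coefficient matrices\<close>

definition coeff_mat :: "nat \<Rightarrow> (nat \<Rightarrow> 'a::comm_ring_1 poly) \<Rightarrow> 'a mat" where
  "coeff_mat n P = mat n n (\<lambda>(i, j). coeff (P i) j)"

lemma coeff_mat_carrier [simp]: "coeff_mat n P \<in> carrier_mat n n"
  by (simp add: coeff_mat_def)

text \<open>Cutting a polynomial to its first \<open>n\<close> coefficients is linear, so linear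
  combinations of polynomials become combinations of rows. Both determinant factorizations below are
  instances.\<close>

lemma det_coeff_mat_lincomb:
  assumes B: "B \<in> carrier_mat n n"
    and P: "\<And>i. i < n \<Longrightarrow> P i = (\<Sum>j<n. smult (B $$ (i, j)) (Q j))"
  shows "det (coeff_mat n P) = det B * det (coeff_mat n Q)"
proof -
  have "coeff_mat n P = B * coeff_mat n Q"
    using B by (intro eq_matI)
      (auto simp: coeff_mat_def P scalar_prod_def coeff_sum lessThan_atLeast0)
  then show ?thesis
    by (simp add: det_mult[OF B coeff_mat_carrier])
qed

section \<open>Row polynomials of the Sylvester matrix\<close>

definition sylv_polys :: "'a::comm_ring_1 poly list \<Rightarrow> 'a poly list" where
  "sylv_polys gs =
     concat (map (\<lambda>k. map (\<lambda>p. monom 1 p * cofactor_poly gs k) [0..<degree (gs ! k)])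
       [0..<length gs])"

lemma cofactor_poly_Cons_0: "cofactor_poly (f # hs) 0 = prod_list hs"
proof -
  have "{..<length (f # hs)} - {0} = Suc ` {..<length hs}"
    by (auto simp: lessThan_Suc_eq_insert_0)
  then show ?thesis
    by (simp add: cofactor_poly_def prod.reindex prod.list_conv_set_nth atLeast0LessThan)
qed

lemma cofactor_poly_Cons_Suc:
  assumes "k < length hs"
  shows "cofactor_poly (f # hs) (Suc k) = f * cofactor_poly hs k"
proof -
  have "{..<length (f # hs)} - {Suc k} = insert 0 (Suc ` ({..<length hs} - {k}))"
    by (auto simp: lessThan_Suc_eq_insert_0)
  then show ?thesis
    by (simp add: cofactor_poly_def prod.reindex)
qed

lemma total_degree_Cons: "total_degree (f # hs) = degree f + total_degree hs"
  by (simp add: total_degree_def sum.lessThan_Suc_shift del: sum.lessThan_Suc)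

lemma sylv_polys_Nil: "sylv_polys [] = []"
  by (simp add: sylv_polys_def)

text \<open>Omitting \<open>f\<close> leaves the product of \<open>hs\<close>, while every other
  cofactor keeps \<open>f\<close> as a factor.\<close>

lemma sylv_polys_Cons:
  "sylv_polys (f # hs) =
     map (\<lambda>p. monom 1 p * prod_list hs) [0..<degree f] @ map ((*) f) (sylv_polys hs)"
proof -
  have upt: "[0..<length (f # hs)] = 0 # map Suc [0..<length hs]"
    by (simp add: map_Suc_upt upt_conv_Cons del: upt_Suc)
  have "map (\<lambda>k. map (\<lambda>p. monom 1 p * cofactor_poly (f # hs) (Suc k)) [0..<degree (hs ! k)])
          [0..<length hs] =
        map (\<lambda>k. map ((*) f) (map (\<lambda>p. monom 1 p * cofactor_poly hs k) [0..<degree (hs ! k)]))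
          [0..<length hs]"
    by (intro map_cong) (simp_all add: cofactor_poly_Cons_Suc mult.left_commute)
  from arg_cong[OF this, of concat] show ?thesis
    unfolding sylv_polys_def upt map_concat
    by (simp add: cofactor_poly_Cons_0 o_def del: upt_Suc)
qed

lemma length_sylv_polys: "length (sylv_polys gs) = total_degree gs"
  by (induction gs) (simp_all add: sylv_polys_Nil sylv_polys_Cons total_degree_Cons,
      simp add: total_degree_def)

lemma degree_prod_list_monic:
  fixes hs :: "'a::idom poly list"
  assumes "\<And>h. h \<in> set hs \<Longrightarrow> lead_coeff h = 1"
  shows "degree (prod_list hs) = total_degree hs"
  using assms
proof (induction hs)
  case Nil
  show ?case by (simp add: total_degree_def)
next
  case (Cons f hs)
  have "lead_coeff f = 1" "lead_coeff (prod_list hs) = 1"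
    using Cons.prems by (auto intro: monic_prod_list)
  then have "f \<noteq> 0" "prod_list hs \<noteq> 0"
    by (auto simp del: prod_list_zero_iff)
  then show ?case
    using Cons by (simp add: total_degree_Cons degree_mult_eq del: prod_list_zero_iff)
qed

lemma degree_cofactor_poly:
  fixes gs :: "'a::idom poly list"
  assumes "\<And>g. g \<in> set gs \<Longrightarrow> lead_coeff g = 1" "k < length gs"
  shows "degree (cofactor_poly gs k) = total_degree gs - degree (gs ! k)"
  using assms
proof (induction gs arbitrary: k)
  case (Cons f hs)
  show ?case
  proof (cases k)
    case 0
    then show ?thesis
      using Cons.prems degree_prod_list_monic[of hs]
      by (simp add: cofactor_poly_Cons_0 total_degree_Cons)
  next
    case (Suc l)
    have l: "l < length hs" using Cons.prems Suc by simp
    have m: "\<And>j. j < length hs \<Longrightarrow> hs ! j \<noteq> 0"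
      using Cons.prems(1) by (metis leading_coeff_0_iff list.set_intros(2) nth_mem zero_neq_one)
    have "f \<noteq> 0" using Cons.prems(1)[of f] by auto
    moreover have "cofactor_poly hs l \<noteq> 0"
      using m by (auto simp: cofactor_poly_def)
    moreover have "degree (hs ! l) \<le> total_degree hs"
      unfolding total_degree_def by (rule member_le_sum) (use l in auto)
    ultimately show ?thesis
      using Cons.IH[of l] Cons.prems l
      by (simp add: Suc cofactor_poly_Cons_Suc total_degree_Cons degree_mult_eq)
  qed
qed simp

text \<open>Coefficient vectors of length \<open>total_degree gs\<close> therefore lose nothing,
  which permits the expansion in powers of \<open>X\<close> in \<open>Res_Cons\<close>.\<close>

lemma degree_sylv_polys:
  fixes gs :: "'a::idom poly list"
  assumes "\<And>g. g \<in> set gs \<Longrightarrow> lead_coeff g = 1" "P \<in> set (sylv_polys gs)"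
  shows "degree P < total_degree gs"
proof -
  obtain k p where k: "k < length gs" "p < degree (gs ! k)" "P = monom 1 p * cofactor_poly gs k"
    using assms(2) by (auto simp: sylv_polys_def)
  have "degree (gs ! k) \<le> total_degree gs"
    unfolding total_degree_def by (rule member_le_sum) (use k in auto)
  moreover have "degree P \<le> p + degree (cofactor_poly gs k)"
    unfolding k by (rule order.trans[OF degree_mult_le]) (simp add: degree_monom_eq)
  ultimately show ?thesis
    using k degree_cofactor_poly[OF assms(1) k(1)] by linarith
qed

text \<open>For monic input the cutoff in \<open>sylv_row\<close> is the exact degree of the
  cofactor, so the zeros prescribed beyond it are true coefficients.\<close>

lemma Sylv_eq_coeff_mat:
  fixes gs :: "'a::idom poly list"
  assumes "\<And>g. g \<in> set gs \<Longrightarrow> lead_coeff g = 1"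
  shows "Sylv gs = coeff_mat (total_degree gs) ((!) (sylv_polys gs))"
proof -
  let ?M = "total_degree gs"
  have row: "sylv_row gs k p = vec ?M (coeff (monom 1 p * cofactor_poly gs k))"
    if "k < length gs" for k p
    using degree_cofactor_poly[OF assms that]
    by (auto simp: sylv_row_def coeff_monom_mult intro!: eq_vecI coeff_eq_0)
  have rows: "concat (map (\<lambda>k. map (sylv_row gs k) [0..<degree (gs ! k)]) [0..<length gs]) =
      map (\<lambda>P. vec ?M (coeff P)) (sylv_polys gs)"
    unfolding sylv_polys_def map_concat
    by (auto simp: row o_def intro!: arg_cong[where f = concat])
  show ?thesis
    unfolding Sylv_def rows
    by (intro eq_matI) (auto simp: coeff_mat_def mat_of_rows_def length_sylv_polys)
qed

section \<open>Splitting off the first polynomial\<close>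

lemma Res_Nil: "Res [] = 1"
  by (simp add: Res_def Sylv_def total_degree_def det_def mat_of_rows_def)

lemma Res_pair_eq:
  fixes f g :: "'a::idom poly"
  assumes "lead_coeff f = 1" "lead_coeff g = 1"
  shows "Res [f, g] = det (coeff_mat (degree f + degree g)
    (\<lambda>i. if i < degree f then monom 1 i * g else f * monom 1 (i - degree f)))"
proof -
  have td: "total_degree [f, g] = degree f + degree g"
    by (simp add: total_degree_def)
  have "coeff_mat (total_degree [f, g]) ((!) (sylv_polys [f, g])) =
      coeff_mat (degree f + degree g)
        (\<lambda>i. if i < degree f then monom 1 i * g else f * monom 1 (i - degree f))"
    unfolding td by (intro eq_matI)
      (auto simp: coeff_mat_def sylv_polys_Cons sylv_polys_Nil nth_append)
  moreover have "Sylv [f, g] = coeff_mat (total_degree [f, g]) ((!) (sylv_polys [f, g]))"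
    using assms by (intro Sylv_eq_coeff_mat) auto
  ultimately show ?thesis
    by (simp add: Res_def)
qed

lemma sum_lessThan_add:
  fixes h :: "nat \<Rightarrow> 'b::comm_monoid_add"
  shows "(\<Sum>j<m + n. h j) = (\<Sum>j<m. h j) + (\<Sum>j<n. h (m + j))"
  by (induction n) (simp_all add: add_ac)

lemma poly_eq_sum_smult_monom:
  fixes p :: "'a::comm_semiring_1 poly"
  assumes "degree p < n"
  shows "p = (\<Sum>j<n. smult (coeff p j) (monom 1 j))"
  using assms by (intro poly_eqI) (simp add: coeff_sum sum.delta coeff_eq_0 if_distrib cong: if_cong)

lemma Res_Cons:
  fixes f :: "'a::idom poly"
  assumes f: "lead_coeff f = 1" and hs: "\<And>h. h \<in> set hs \<Longrightarrow> lead_coeff h = 1"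
  shows "Res (f # hs) = Res hs * Res [f, prod_list hs]"
proof -
  let ?m = "degree f" and ?n = "total_degree hs"
  let ?S = "coeff_mat ?n ((!) (sylv_polys hs))"
  \<comment> \<open>The rows of \<open>f # hs\<close> are written through those of the pair
    \<open>f\<close>, \<open>prod_list hs\<close>. The first blocks agree; in the second,
    \<open>f * p\<close> has with respect to the \<open>f * monom 1 j\<close> the coefficients of
    the row polynomial \<open>p\<close> of \<open>hs\<close>.\<close>
  let ?B = "four_block_mat (1\<^sub>m ?m) (0\<^sub>m ?m ?n) (0\<^sub>m ?n ?m) ?S"
  let ?P = "(!) (sylv_polys (f # hs))"
  let ?Q = "\<lambda>i. if i < ?m then monom 1 i * prod_list hs else f * monom 1 (i - ?m)"
  have S: "Sylv hs = ?S" using hs by (rule Sylv_eq_coeff_mat)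
  have B: "?B \<in> carrier_mat (?m + ?n) (?m + ?n)"
    by (intro four_block_carrier_mat) auto
  have "?P i = (\<Sum>j<?m + ?n. smult (?B $$ (i, j)) (?Q j))" if i: "i < ?m + ?n" for i
  proof (cases "i < ?m")
    case True
    then show ?thesis
      by (simp add: sylv_polys_Cons nth_append sum_lessThan_add coeff_mat_def
          sum.delta if_distrib[where f = "\<lambda>c. smult c _"] cong: if_cong)
  next
    case False
    let ?p = "sylv_polys hs ! (i - ?m)"
    have "?p \<in> set (sylv_polys hs)"
      using False i by (simp add: length_sylv_polys)
    then have "degree ?p < ?n" using hs by (blast intro: degree_sylv_polys)
    then have "f * ?p = f * (\<Sum>j<?n. smult (coeff ?p j) (monom 1 j))"
      using poly_eq_sum_smult_monom by metis
    also have "\<dots> = (\<Sum>j<?m + ?n. smult (?B $$ (i, j)) (?Q j))"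
      using False i by (simp add: sum_lessThan_add coeff_mat_def sum_distrib_left)
    finally show ?thesis
      using False i by (simp add: sylv_polys_Cons nth_append length_sylv_polys)
  qed
  then have "det (coeff_mat (?m + ?n) ?P) = det ?B * det (coeff_mat (?m + ?n) ?Q)"
    by (rule det_coeff_mat_lincomb[OF B])
  moreover have "Sylv (f # hs) = coeff_mat (?m + ?n) ?P"
    using f hs Sylv_eq_coeff_mat[of "f # hs"] by (auto simp: total_degree_Cons)
  moreover have "det ?B = det ?S"
    by (subst det_four_block_mat_lower_left_zero) auto
  moreover have "Res [f, prod_list hs] = det (coeff_mat (?m + ?n) ?Q)"
    using Res_pair_eq[OF f, of "prod_list hs"] monic_prod_list[of hs] degree_prod_list_monic[of hs] hs by simp
  ultimately show ?thesis
    by (simp add: Res_def S)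
qed

section \<open>Multiplication modulo a monic polynomial\<close>

text \<open>\<open>A\<close> represents multiplication by \<open>g\<close> on \<open>R[X]/(f)\<close> in the basis of powers of \<open>X\<close>.\<close>

definition mult_matrix_mod :: "'a::comm_ring_1 poly \<Rightarrow> 'a poly \<Rightarrow> 'a mat \<Rightarrow> bool" where
  "mult_matrix_mod f g A \<longleftrightarrow> A \<in> carrier_mat (degree f) (degree f) \<and>
     (\<forall>i<degree f. f dvd monom 1 i * g - (\<Sum>j<degree f. smult (A $$ (i, j)) (monom 1 j)))"

lemma mult_matrix_mod_exists:
  fixes f :: "'a::idom poly"
  assumes "lead_coeff f = 1"
  shows "\<exists>A. mult_matrix_mod f g A"
proof -
  let ?m = "degree f"
  let ?r = "\<lambda>i. pseudo_mod (monom 1 i * g) f"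
  let ?A = "coeff_mat ?m ?r"
  have f0: "f \<noteq> 0" using assms by auto
  have "f dvd monom 1 i * g - (\<Sum>j<?m. smult (?A $$ (i, j)) (monom 1 j))" if i: "i < ?m" for i
  proof -
    \<comment> \<open>A zero remainder also satisfies this bound, because \<open>i < ?m\<close>
      forces \<open>?m\<close> to be positive.\<close>
    have deg: "degree (?r i) < ?m"
      using pseudo_mod(2)[OF f0, of "monom 1 i * g"] i by auto
    \<comment> \<open>Pseudo-division scales the dividend by a power of the leading coefficient of
      \<open>f\<close>, which is 1 here.\<close>
    obtain q where "monom 1 i * g = f * q + ?r i"
      using pseudo_divmod[OF f0 prod.collapse[symmetric], of "monom 1 i * g"] assms
      by (auto simp: pseudo_mod_def)
    then have "f dvd monom 1 i * g - ?r i"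
      by (metis add_diff_cancel_right' dvd_triv_left)
    moreover have "(\<Sum>j<?m. smult (?A $$ (i, j)) (monom 1 j)) = ?r i"
      using i by (subst poly_eq_sum_smult_monom[OF deg]) (simp add: coeff_mat_def)
    ultimately show ?thesis by simp
  qed
  then show ?thesis
    unfolding mult_matrix_mod_def by (intro exI[of _ ?A]) simp
qed

lemma mult_matrix_mod_one: "mult_matrix_mod f 1 (1\<^sub>m (degree f))"
  unfolding mult_matrix_mod_def
  by (simp add: sum.delta if_distrib[where f = "\<lambda>c. smult c _"] cong: if_cong)

text \<open>Row \<open>i\<close> represents the image of \<open>monom 1 i\<close>, so multiplying by
  \<open>g\<close> first and by \<open>h\<close> second gives \<open>A * B\<close> in this
  order.\<close>

lemma mult_matrix_mod_mult:
  fixes f :: "'a::comm_ring_1 poly"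
  assumes A: "mult_matrix_mod f g A" and B: "mult_matrix_mod f h B"
  shows "mult_matrix_mod f (g * h) (A * B)"
proof -
  let ?m = "degree f"
  have carr: "A \<in> carrier_mat ?m ?m" "B \<in> carrier_mat ?m ?m"
    using A B by (auto simp: mult_matrix_mod_def)
  have "f dvd monom 1 i * (g * h) - (\<Sum>j<?m. smult ((A * B) $$ (i, j)) (monom 1 j))"
    if i: "i < ?m" for i
  proof -
    let ?s = "\<lambda>k. \<Sum>j<?m. smult (B $$ (k, j)) (monom 1 j)"
    let ?t = "\<Sum>k<?m. smult (A $$ (i, k)) (monom 1 k)"
    have "(\<Sum>j<?m. smult ((A * B) $$ (i, j)) (monom 1 j)) =
        (\<Sum>j<?m. \<Sum>k<?m. smult (A $$ (i, k) * B $$ (k, j)) (monom 1 j))"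
      using carr i by (simp add: scalar_prod_def smult_sum lessThan_atLeast0)
    also have "\<dots> = (\<Sum>k<?m. smult (A $$ (i, k)) (?s k))"
      by (subst sum.swap) (simp add: smult_sum2)
    finally have AB: "(\<Sum>j<?m. smult ((A * B) $$ (i, j)) (monom 1 j)) =
      (\<Sum>k<?m. smult (A $$ (i, k)) (?s k))" .
    \<comment> \<open>The total error is the error of \<open>A\<close> times \<open>h\<close> plus a
      combination of the errors of \<open>B\<close>; \<open>f\<close> divides each of them.\<close>
    have "monom 1 i * (g * h) - (\<Sum>k<?m. smult (A $$ (i, k)) (?s k)) =
        (monom 1 i * g - ?t) * h + (\<Sum>k<?m. smult (A $$ (i, k)) (monom 1 k * h - ?s k))"
      by (simp add: algebra_simps sum_subtractf sum_distrib_left sum_distrib_right smult_diff_right)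
    moreover have "f dvd (monom 1 i * g - ?t) * h"
      using A i by (simp add: mult_matrix_mod_def)
    moreover have "f dvd (\<Sum>k<?m. smult (A $$ (i, k)) (monom 1 k * h - ?s k))"
      using B by (intro dvd_sum dvd_smult) (simp add: mult_matrix_mod_def)
    ultimately show ?thesis
      unfolding AB by simp
  qed
  then show ?thesis
    using carr by (auto simp: mult_matrix_mod_def)
qed

text \<open>Each \<open>monom 1 i * g\<close> is a remainder, given by row \<open>i\<close> of
  \<open>A\<close>, plus a multiple of \<open>f\<close>. Clearing these multiples with the rows
  \<open>f * monom 1 j\<close> leaves \<open>A\<close> and a unitriangular system.\<close>

lemma Res_pair_eq_det:
  fixes f g :: "'a::idom poly"
  assumes f: "lead_coeff f = 1" and g: "lead_coeff g = 1" and A: "mult_matrix_mod f g A"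
  shows "Res [f, g] = det A"
proof -
  let ?m = "degree f" and ?n = "degree g"
  let ?P = "\<lambda>i. if i < ?m then monom 1 i * g else f * monom 1 (i - ?m)"
  let ?Q = "\<lambda>i. if i < ?m then monom 1 i else f * monom 1 (i - ?m)"
  have carr: "A \<in> carrier_mat ?m ?m"
    using A by (simp add: mult_matrix_mod_def)
  define s where "s i = (\<Sum>j<?m. smult (A $$ (i, j)) (monom 1 j))" for i
  have "\<exists>q. \<forall>i<?m. monom 1 i * g - s i = f * q i"
    using A unfolding mult_matrix_mod_def s_def dvd_def by metis
  then obtain q where q: "\<And>i. i < ?m \<Longrightarrow> monom 1 i * g - s i = f * q i" by blast
  \<comment> \<open>The upper blocks hold the remainder and the quotient coefficients; the rows
    \<open>f * monom 1 j\<close> stay as they are.\<close>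
  let ?B = "four_block_mat A (mat ?m ?n (\<lambda>(i, j). coeff (q i) j)) (0\<^sub>m ?n ?m) (1\<^sub>m ?n)"
  have B: "?B \<in> carrier_mat (?m + ?n) (?m + ?n)"
    using carr by (intro four_block_carrier_mat) auto
  have f0: "f \<noteq> 0" using f by auto
  have g0: "g \<noteq> 0" using g by auto
  have "?P i = (\<Sum>j<?m + ?n. smult (?B $$ (i, j)) (?Q j))" if i: "i < ?m + ?n" for i
  proof (cases "i < ?m")
    case True
    \<comment> \<open>The quotient must fit into \<open>?n\<close> columns. It does, since
      \<open>f * q i\<close> has degree below \<open>?m + ?n\<close>; a zero quotient is treated
      apart because \<open>?n\<close> may be 0.\<close>
    have qsum: "q i = (\<Sum>j<?n. smult (coeff (q i) j) (monom 1 j))"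
    proof (cases "q i = 0")
      case False
      have "degree (s i) < ?m + ?n"
      proof -
        have "degree (s i) \<le> ?m - 1"
          unfolding s_def by (intro degree_sum_le order.trans[OF degree_smult_le])
            (auto simp: degree_monom_eq)
        then show ?thesis using True by linarith
      qed
      moreover have "degree (monom 1 i * g) < ?m + ?n"
        using True g0 by (simp add: degree_mult_eq degree_monom_eq)
      ultimately have "degree (f * q i) < ?m + ?n"
        unfolding q[OF True, symmetric] by (metis degree_diff_le_max le_less_trans max_less_iff_conj)
      then have "degree (q i) < ?n"
        using False f0 by (simp add: degree_mult_eq)
      then show ?thesis by (rule poly_eq_sum_smult_monom)
    qed simp
    have "monom 1 i * g = s i + f * q i"
      using q[OF True] by (simp add: algebra_simps)
    also have "\<dots> = s i + (\<Sum>j<?n. smult (coeff (q i) j) (f * monom 1 j))"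
      by (subst qsum) (simp add: sum_distrib_left)
    finally show ?thesis
      using True carr by (simp add: s_def sum_lessThan_add)
  next
    case False
    then show ?thesis
      using i carr by (simp add: sum_lessThan_add sum.delta
          if_distrib[where f = "\<lambda>c. smult c _"] cong: if_cong)
  qed
  then have "det (coeff_mat (?m + ?n) ?P) = det ?B * det (coeff_mat (?m + ?n) ?Q)"
    by (rule det_coeff_mat_lincomb[OF B])
  moreover have "det ?B = det A"
    using carr by (subst det_four_block_mat_lower_left_zero) auto
  moreover have "det (coeff_mat (?m + ?n) ?Q) = 1"
  proof -
    \<comment> \<open>Each \<open>?Q i\<close> is monic of degree \<open>i\<close>, so its
      coefficient matrix is lower triangular with unit diagonal.\<close>
    have Q: "degree (?Q i) = i" "coeff (?Q i) i = 1" for i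
      using f f0 by (auto simp: degree_mult_eq degree_monom_eq coeff_monom_mult mult.commute[of f])
    have "det (coeff_mat (?m + ?n) ?Q) = prod_list (diag_mat (coeff_mat (?m + ?n) ?Q))"
    proof (rule det_lower_triangular[OF _ coeff_mat_carrier])
      fix i j assume "i < j" "j < ?m + ?n"
      moreover have "coeff (?Q i) j = 0"
        by (rule coeff_eq_0) (use \<open>i < j\<close> Q(1)[of i] in simp)
      ultimately show "coeff_mat (?m + ?n) ?Q $$ (i, j) = 0"
        by (simp add: coeff_mat_def)
    qed
    also have "diag_mat (coeff_mat (?m + ?n) ?Q) = map (\<lambda>_. 1) [0..<?m + ?n]"
      using Q(2) by (auto simp: diag_mat_def coeff_mat_def)
    finally show ?thesis by (simp add: map_replicate_const)
  qed
  ultimately show ?thesis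
    by (simp add: Res_pair_eq[OF f g])
qed

section \<open>Multiplicativity and the product over pairs\<close>

lemma Res_prod_list_right:
  fixes f :: "'a::idom poly"
  assumes f: "lead_coeff f = 1" and "\<And>h. h \<in> set hs \<Longrightarrow> lead_coeff h = 1"
  shows "Res [f, prod_list hs] = (\<Prod>h\<leftarrow>hs. Res [f, h])"
  using assms(2)
proof (induction hs)
  case Nil
  show ?case
    using Res_pair_eq_det[OF f _ mult_matrix_mod_one] by simp
next
  case (Cons h hs)
  have h: "lead_coeff h = 1" and hs: "lead_coeff (prod_list hs) = 1"
    using Cons.prems monic_prod_list[of hs] by auto
  obtain A B where A: "mult_matrix_mod f h A" and B: "mult_matrix_mod f (prod_list hs) B"
    using mult_matrix_mod_exists[OF f] by metis
  have "Res [f, h * prod_list hs] = det (A * B)"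
    using h hs by (intro Res_pair_eq_det[OF f _ mult_matrix_mod_mult[OF A B]])
      (simp add: lead_coeff_mult)
  also have "\<dots> = det A * det B"
    using A B by (intro det_mult) (auto simp: mult_matrix_mod_def)
  finally show ?case
    using Res_pair_eq_det[OF f h A] Res_pair_eq_det[OF f hs B] Cons by simp
qed

text \<open>Pairs with first index 0 are separated from the others, which are shifts of pairs below
  \<open>n\<close>; this matches the indexing of \<open>f # hs\<close>.\<close>

lemma prod_pairs_Suc:
  fixes F :: "nat \<Rightarrow> nat \<Rightarrow> 'b::comm_monoid_mult"
  shows "(\<Prod>(k, l)\<in>{(k, l). k < l \<and> l < Suc n}. F k l) =
    (\<Prod>l<n. F 0 (Suc l)) * (\<Prod>(k, l)\<in>{(k, l). k < l \<and> l < n}. F (Suc k) (Suc l))"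
proof -
  let ?A = "(\<lambda>l. (0, Suc l)) ` {..<n}" and ?B = "map_prod Suc Suc ` {(k, l). k < l \<and> l < n}"
  have fin: "finite {(k, l). k < l \<and> l < n}"
    by (rule finite_subset[of _ "{..<n} \<times> {..<n}"]) auto
  have "{(k, l). k < l \<and> l < Suc n} = ?A \<union> ?B"
  proof (intro equalityI subsetI)
    fix x assume "x \<in> {(k, l). k < l \<and> l < Suc n}"
    then obtain k l where "x = (k, l)" "k < l" "l < Suc n" by auto
    then show "x \<in> ?A \<union> ?B"
      by (cases k; cases l) (auto simp: image_iff)
  qed auto
  then have "(\<Prod>(k, l)\<in>{(k, l). k < l \<and> l < Suc n}. F k l) =
      (\<Prod>(k, l)\<in>?A. F k l) * (\<Prod>(k, l)\<in>?B. F k l)"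
    by (simp only:) (rule prod.union_disjoint, use fin in auto)
  moreover have "(\<Prod>(k, l)\<in>?A. F k l) = (\<Prod>l<n. F 0 (Suc l))"
    by (subst prod.reindex) (auto simp: inj_on_def)
  moreover have "(\<Prod>(k, l)\<in>?B. F k l) = (\<Prod>(k, l)\<in>{(k, l). k < l \<and> l < n}. F (Suc k) (Suc l))"
    by (subst prod.reindex) (auto simp: inj_on_def case_prod_unfold)
  ultimately show ?thesis by simp
qed

lemma Res_eq_prod_pairs:
  fixes gs :: "'a::idom poly list"
  assumes "\<And>g. g \<in> set gs \<Longrightarrow> lead_coeff g = 1"
  shows "Res gs = (\<Prod>(k, l)\<in>{(k, l). k < l \<and> l < length gs}. Res [gs ! k, gs ! l])"
  using assms
proof (induction gs)
  case Nil
  \<comment> \<open>Starting at the empty list, whose empty determinant is 1, makes singletons no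
    special case.\<close>
  show ?case by (simp add: Res_Nil)
next
  case (Cons f hs)
  \<comment> \<open>\<open>Res_Cons\<close> leaves the resultant of \<open>f\<close> with the
    product of \<open>hs\<close>, which \<open>Res_prod_list_right\<close> splits into the pairs
    containing \<open>f\<close>.\<close>
  have "Res (f # hs) = (\<Prod>h\<leftarrow>hs. Res [f, h]) * Res hs"
    using Cons.prems by (simp add: Res_Cons Res_prod_list_right mult.commute)
  also have "(\<Prod>h\<leftarrow>hs. Res [f, h]) = (\<Prod>l<length hs. Res [f, hs ! l])"
    by (simp add: prod.list_conv_set_nth atLeast0LessThan)
  finally show ?case
    using Cons by (simp add: prod_pairs_Suc)
qed

theorem lemma5:
  fixes gs :: "'a::idom poly list"
  assumes "length gs \<ge> 1"
    and "\<And>k. k < length gs \<Longrightarrow> lead_coeff (gs ! k) = 1"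
    and "\<And>k. k < length gs \<Longrightarrow> degree (gs ! k) \<ge> 1"
  shows "Res gs = (\<Prod>(k, l)\<in>{(k, l). k < l \<and> l < length gs}. Res [gs ! k, gs ! l])"
  using assms(2) by (intro Res_eq_prod_pairs) (metis in_set_conv_nth)

end
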